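(* Let $b,m$ be integers larger than $1$, let $S$ be a finite weighted subset of $[\![b]\!]^*$, let $l=\max\{|w|: n_{S,w}\neq 0\}$, and let $M_{b,m,S}$ be the associated $b^l\times b^l$ matrix. For each integer $t\ge 0$ let $A_{b,m,S}(t)$ be the column vector of dimension $b^l$ with entries $$A_{b,m,S}(t)(j)=\sum_{n=(j-1)b^{t}}^{jb^{t}-1}a_{b,m,S}(n),\qquad 1\le j\le b^l.$$ Then for every integer $t\ge 0$, $A_{b,m,S}(t+1)=M_{b,m,S}\,A_{b,m,S}(t)$.
   Context: Let $b\ge 2$, $m\ge 2$ be integers, $[\![b]\!]=\{0,\dots,b-1\}$, $[\![b]\!]^*$ the finite words over it; for $w=w[1]\cdots w[|w|]$ put $w'=w[2]\cdots w[|w|]$ and $(w)_b=\sum_{i=1}^{|w|}w[i]b^{|w|-i}$. For $n\ge0$ and a word $w$ with a nonzero letter, $e_{b,w}(n)$ is the number of occurrences of $w$ as a block of consecutive digits in the base-$b$ expansion of $n$ padded with infinitely many leading zeros. A finite weighted subset $S$ assigns real weights $n_{S,w}$ to words, finitely many nonzero (and zero on all-zero words); $e_{b,S}(n)=\sum_w n_{S,w}e_{b,w}(n)$, $a_{b,m,S}(n)=\exp(2\pi i\,e_{b,S}(n)/m)$. $S$ is proper if $n_{S,w}\neq0$ implies $w[1]\neq0$. Window functions: for a nonempty word $w$, $\alpha^1_w=(w')_b/b^{|w|-1}$, $\alpha^2_w=((w')_b+1)/b^{|w|-1}$; for a finite word $v$ of complex numbers and finite weighted subset $T$, $\phi_{b,m,T}(v)$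 is the word of the same length with $\phi_{b,m,T}(v)[j]=v[j]\exp\!\big(\tfrac{2\pi i}{m}\sum_{w:\ \alpha^1_w|v|<j\le\alpha^2_w|v|}n_{T,w}\big)$. It is known (and used to define the matrix) that there exist proper finite weighted subsets $S_1,\dots,S_{b-1}$ and finite words $(u_t)_{t\ge0}$ of complex numbers with $|u_0|=b^l$, $u_{t+1}=u_t\phi_{b,m,S_1}(u_t)\cdots\phi_{b,m,S_{b-1}}(u_t)$ for all $t$, and $(a_{b,m,S}(n))_n=\lim_t u_t$ (the infinite word having every $u_t$ as a prefix). The associated matrix: fix such $S_1,\dots,S_{b-1}$; let $V_0$ be the word of length $b^l$ all of whose letters are $1$, and $V_k=\phi_{b,m,S_k}(V_0)$ for $1\le k\le b-1$. Then $M_{b,m,S}$ is the $b^l\times b^l$ complex matrix with $M_{b,m,S}(sb^{l-1}+r,\,(r-1)b+t)=V_s[(r-1)b+t]$ for all integers $1\le r\le b^{l-1}$, $0\le s\le b-1$, $1\le t\le b$, and all other entries $0$. *)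

theory Defs
  imports Complex_Main "Jordan_Normal_Form.Matrix"
begin

text \<open>Words are lists, so the letter \<open>w[i]\<close> (counted from 1) is \<open>w ! (i - 1)\<close>. A weighted set
  of words is its weight function, extended by 0 to all lists of naturals.\<close>

definition fin_weighted :: "nat \<Rightarrow> (nat list \<Rightarrow> real) \<Rightarrow> bool" where
  "fin_weighted b S \<longleftrightarrow> finite {w. S w \<noteq> 0} \<and>
     (\<forall>w. S w \<noteq> 0 \<longrightarrow> set w \<subseteq> {0..<b} \<and> (\<exists>x\<in>set w. x \<noteq> 0))"

definition proper_weighted :: "(nat list \<Rightarrow> real) \<Rightarrow> bool" where
  "proper_weighted S \<longleftrightarrow> (\<forall>w. S w \<noteq> 0 \<longrightarrow> hd w \<noteq> 0)"

definition word_val :: "nat \<Rightarrow> nat list \<Rightarrow> nat" where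
  "word_val b w = (\<Sum>i = 1..length w. w ! (i - 1) * b ^ (length w - i))"

definition digit :: "nat \<Rightarrow> nat \<Rightarrow> nat \<Rightarrow> nat" where
  "digit b n i = n div b ^ i mod b"

text \<open>An occurrence is identified by the exponent \<open>i\<close> of the digit matching the last letter of
  \<open>w\<close>. For \<open>i\<close> beyond the expansion of \<open>n\<close> the digits are the padding zeros; the set of
  occurrences is finite because \<open>w\<close> is only used with a nonzero letter.\<close>

definition occ :: "nat \<Rightarrow> nat list \<Rightarrow> nat \<Rightarrow> nat" where
  "occ b w n = card {i. \<forall>k<length w. w ! k = digit b n (i + (length w - 1 - k))}"

definition weighted_occ :: "nat \<Rightarrow> (nat list \<Rightarrow> real) \<Rightarrow> nat \<Rightarrow> real" where
  "weighted_occ b S n = (\<Sum>w | S w \<noteq> 0. S w * real (occ b w n))"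

definition block_seq :: "nat \<Rightarrow> nat \<Rightarrow> (nat list \<Rightarrow> real) \<Rightarrow> nat \<Rightarrow> complex" where
  "block_seq b m S n =
     exp (2 * complex_of_real pi * \<i> * complex_of_real (weighted_occ b S n) / of_nat m)"

definition win_lo :: "nat \<Rightarrow> nat list \<Rightarrow> real" where
  "win_lo b w = real (word_val b (tl w)) / real b ^ (length w - 1)"

definition win_hi :: "nat \<Rightarrow> nat list \<Rightarrow> real" where
  "win_hi b w = real (word_val b (tl w) + 1) / real b ^ (length w - 1)"

definition phi :: "nat \<Rightarrow> nat \<Rightarrow> (nat list \<Rightarrow> real) \<Rightarrow> complex list \<Rightarrow> complex list" where
  "phi b m T v = map (\<lambda>j. v ! (j - 1) *
      exp (2 * complex_of_real pi * \<i> / of_nat m *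
        complex_of_real (\<Sum>w | T w \<noteq> 0 \<and> win_lo b w * real (length v) < real j
                                        \<and> real j \<le> win_hi b w * real (length v). T w)))
    [1..<Suc (length v)]"

text \<open>\<open>Ss k\<close> is relevant only for \<open>1 \<le> k \<le> b - 1\<close>. The limit clause says that every \<open>u t\<close> is a
  prefix of \<open>block_seq b m S\<close>; the recursion gives \<open>u t\<close> length \<open>b ^ (l + t)\<close>.\<close>

definition generating_family ::
  "nat \<Rightarrow> nat \<Rightarrow> nat \<Rightarrow> (nat list \<Rightarrow> real) \<Rightarrow> (nat \<Rightarrow> nat list \<Rightarrow> real) \<Rightarrow> bool" where
  "generating_family b m l S Ss \<longleftrightarrow>
     (\<forall>k\<in>{1..b - 1}. fin_weighted b (Ss k) \<and> proper_weighted (Ss k)) \<and>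
     (\<exists>u :: nat \<Rightarrow> complex list.
        length (u 0) = b ^ l \<and>
        (\<forall>t. u (Suc t) = u t @ concat (map (\<lambda>k. phi b m (Ss k) (u t)) [1..<b])) \<and>
        (\<forall>t. \<forall>n<length (u t). u t ! n = block_seq b m S n))"

definition V_word :: "nat \<Rightarrow> nat \<Rightarrow> nat \<Rightarrow> (nat \<Rightarrow> nat list \<Rightarrow> real) \<Rightarrow> nat \<Rightarrow> complex list" where
  "V_word b m l Ss k =
     (if k = 0 then replicate (b ^ l) 1 else phi b m (Ss k) (replicate (b ^ l) 1))"

text \<open>Matrix and vector indices start at 0. The two lemmas after the definition restate it with
  indices starting at 1.\<close>

definition assoc_mat :: "nat \<Rightarrow> nat \<Rightarrow> nat \<Rightarrow> (nat \<Rightarrow> nat list \<Rightarrow> real) \<Rightarrow> complex mat" where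
  "assoc_mat b m l Ss = mat (b ^ l) (b ^ l)
     (\<lambda>(i, j). if j div b = i mod b ^ (l - 1) then V_word b m l Ss (i div b ^ (l - 1)) ! j else 0)"

lemma assoc_mat_entry:
  assumes "l \<ge> 1" "r \<in> {1..b ^ (l - 1)}" "s < b" "t \<in> {1..b}"
  shows "assoc_mat b m l Ss $$ (s * b ^ (l - 1) + r - 1, (r - 1) * b + t - 1)
           = V_word b m l Ss s ! ((r - 1) * b + t - 1)"
proof -
  obtain q where r: "r = Suc q" using assms(2) by (cases r) auto
  obtain p where t: "t = Suc p" using assms(4) by (cases t) auto
  have q: "q < b ^ (l - 1)" and p: "p < b" using assms r t by auto
  have bl: "b ^ l = b * b ^ (l - 1)" using assms(1) by (cases l) auto
  have "s * b ^ (l - 1) + q < Suc s * b ^ (l - 1)" using q by simp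
  also have "\<dots> \<le> b ^ l" unfolding bl using assms(3) by (intro mult_right_mono) auto
  finally have row: "s * b ^ (l - 1) + q < b ^ l" .
  have "q * b + p < Suc q * b" using p by simp
  also have "\<dots> \<le> b ^ (l - 1) * b" using q by (intro mult_right_mono) auto
  finally have col: "q * b + p < b ^ l" by (simp add: bl mult.commute)
  have "(q * b + p) div b = q" using p by simp
  moreover have "(s * b ^ (l - 1) + q) mod b ^ (l - 1) = q" using q by simp
  moreover have "(s * b ^ (l - 1) + q) div b ^ (l - 1) = s"
    using q by (intro div_nat_eqI) auto
  ultimately show ?thesis using row col by (simp add: assoc_mat_def r t)
qed

lemma assoc_mat_zero:
  assumes "b \<ge> 2" "l \<ge> 1" "i \<in> {1..b ^ l}" "j \<in> {1..b ^ l}"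
    and "\<not> (\<exists>s r t. r \<in> {1..b ^ (l - 1)} \<and> s < b \<and> t \<in> {1..b} \<and>
              i = s * b ^ (l - 1) + r \<and> j = (r - 1) * b + t)"
  shows "assoc_mat b m l Ss $$ (i - 1, j - 1) = 0"
proof -
  have bl: "b ^ l = b * b ^ (l - 1)" using assms(2) by (cases l) auto
  define s where "s = (i - 1) div b ^ (l - 1)"
  define r where "r = (i - 1) mod b ^ (l - 1) + 1"
  define t where "t = (j - 1) mod b + 1"
  have "(j - 1) div b \<noteq> (i - 1) mod b ^ (l - 1)"
  proof
    assume eq: "(j - 1) div b = (i - 1) mod b ^ (l - 1)"
    have "i = s * b ^ (l - 1) + r"
      using assms(3) div_mult_mod_eq[of "i - 1" "b ^ (l - 1)"] by (auto simp: s_def r_def)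
    moreover have "j = (r - 1) * b + t"
      using assms(4) div_mult_mod_eq[of "j - 1" b]
      unfolding r_def t_def add_diff_cancel_right' eq[symmetric] by simp
    moreover have "s < b"
      unfolding s_def using assms(1,3) by (intro less_mult_imp_div_less) (auto simp: bl)
    moreover have "r \<in> {1..b ^ (l - 1)}"
      using assms(1) by (auto simp: r_def Suc_le_eq)
    moreover have "t \<in> {1..b}"
      using assms(1) by (auto simp: t_def Suc_le_eq)
    ultimately show False using assms(5) by blast
  qed
  moreover have "i - 1 < b ^ l" "j - 1 < b ^ l" using assms(3,4) by auto
  ultimately show ?thesis by (simp add: assoc_mat_def)
qed

definition block_sums :: "nat \<Rightarrow> nat \<Rightarrow> nat \<Rightarrow> (nat list \<Rightarrow> real) \<Rightarrow> nat \<Rightarrow> complex vec" where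
  "block_sums b m l S t =
     vec (b ^ l) (\<lambda>i. \<Sum>n = i * b ^ t..<(i + 1) * b ^ t. block_seq b m S n)"

end

theory Submission
  imports Defs
begin

text \<open>Put \<open>N = s * b ^ (l + t) + n\<close> with \<open>n < b ^ (l + t)\<close>. An occurrence of a word of length at
  most \<open>l\<close> either has its last letter among the \<open>t\<close> lowest digits, and then it only sees digits
  common to \<open>N\<close> and \<open>n\<close>, or it survives the deletion of these \<open>t\<close> digits. Hence
  \<open>a N / a n = a (s * b ^ l + n div b ^ t) / a (n div b ^ t)\<close>, and the recursion at step 0 says
  that the right-hand side is the letter of \<open>V\<^sub>s\<close> with index \<open>n div b ^ t\<close>. Summing over blocks
  of length \<open>b ^ t\<close> gives the matrix identity.\<close>

text \<open>Named so that occurrences can be sorted by the exponent of their last letter before they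
  are counted.\<close>

definition occ_set :: "nat \<Rightarrow> nat list \<Rightarrow> nat \<Rightarrow> nat set" where
  "occ_set b w n = {i. \<forall>k<length w. w ! k = digit b n (i + (length w - 1 - k))}"

lemma occ_eq_card: "occ b w n = card (occ_set b w n)"
  by (simp only: occ_def occ_set_def)

lemma digit_shift: "digit b n (i + t) = digit b (n div b ^ t) i"
  by (simp add: digit_def power_add div_mult2_eq mult.commute[of "b ^ i"])

lemma digit_high_eq_0:
  assumes "b > 1" "n \<le> i"
  shows "digit b n i = 0"
proof -
  have "n < b ^ i"
    using assms less_exp[of n] power_increasing[OF assms(2), of b]
      power_mono[of 2 b n] by linarith
  then show ?thesis by (simp add: digit_def)
qed

lemma digit_add_mult_power:
  assumes "i < k"
  shows "digit b (s * b ^ k + n) i = digit b n i"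
proof (cases "b = 0")
  case False
  obtain d where k: "k = Suc (i + d)" using assms less_iff_Suc_add by blast
  \<comment> \<open>One factor \<open>b\<close> is kept apart: the quotient by \<open>b ^ i\<close>
    grows by a multiple of \<open>b\<close>, which \<open>mod b\<close> does not see.\<close>
  have eq: "s * b ^ k + n = n + (s * b ^ d * b) * b ^ i"
    by (simp add: k power_add algebra_simps)
  then have "(s * b ^ k + n) div b ^ i = s * b ^ d * b + n div b ^ i"
    unfolding eq using False by (intro div_mult_self1) simp
  then show ?thesis unfolding digit_def by (metis mod_mult_self3)
qed (use assms in \<open>simp add: digit_def zero_power\<close>)

text \<open>A nonzero letter cannot match a padding zero, and by \<open>n < b ^ n\<close> all digits
  of \<open>n\<close> at exponents from \<open>n\<close> on are padding. Without finiteness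
  \<open>card\<close> would be 0 and not additive.\<close>

lemma finite_occ_set:
  assumes "b > 1" "\<exists>x\<in>set w. x \<noteq> 0"
  shows "finite (occ_set b w n)"
proof -
  obtain k where k: "k < length w" "w ! k \<noteq> 0"
    using assms(2) by (auto simp: in_set_conv_nth)
  have "i < n" if "i \<in> occ_set b w n" for i
  proof (rule ccontr)
    assume "\<not> i < n"
    then have "digit b n (i + (length w - 1 - k)) = 0"
      by (intro digit_high_eq_0 assms(1)) simp
    with that k show False by (simp add: occ_set_def)
  qed
  then show ?thesis by (intro finite_subset[OF _ finite_lessThan[of n]]) auto
qed

text \<open>Deleting the \<open>t\<close> lowest digits moves the occurrences at exponents from
  \<open>t\<close> on down by \<open>t\<close>, bijectively.\<close>

lemma occ_split:
  assumes "b > 1" "\<exists>x\<in>set w. x \<noteq> 0"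
  shows "occ b w n = card (occ_set b w n \<inter> {..<t}) + occ b w (n div b ^ t)"
proof -
  have mem: "i + t \<in> occ_set b w n \<longleftrightarrow> i \<in> occ_set b w (n div b ^ t)" for i
  proof -
    have "digit b n (i + t + j) = digit b (n div b ^ t) (i + j)" for j
      using digit_shift[of b n "i + j" t] by (simp add: ac_simps)
    then show ?thesis by (simp only: occ_set_def mem_Collect_eq)
  qed
  have high: "occ_set b w n \<inter> {t..} = (\<lambda>i. i + t) ` occ_set b w (n div b ^ t)"
  proof (intro equalityI subsetI)
    fix i assume i: "i \<in> occ_set b w n \<inter> {t..}"
    then have "i = (i - t) + t" by simp
    with i mem[of "i - t"] show "i \<in> (\<lambda>i. i + t) ` occ_set b w (n div b ^ t)"
      by (metis IntD1 imageI)
  qed (use mem in auto)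
  have "occ_set b w n = (occ_set b w n \<inter> {..<t}) \<union> (occ_set b w n \<inter> {t..})"
    by auto
  moreover have "card \<dots> = card (occ_set b w n \<inter> {..<t}) + card (occ_set b w n \<inter> {t..})"
    using finite_occ_set[OF assms] by (intro card_Un_disjoint) auto
  ultimately show ?thesis
    by (simp add: occ_eq_card high card_image)
qed

lemma occ_exchange:
  assumes "b > 1" "\<exists>x\<in>set w. x \<noteq> 0" "length w \<le> l"
  shows "occ b w (s * b ^ (l + t) + n) + occ b w (n div b ^ t)
    = occ b w n + occ b w (s * b ^ l + n div b ^ t)"
proof -
  \<comment> \<open>The largest exponent read is at most \<open>(t - 1) + (l - 1)\<close>, below the
    exponent \<open>l + t\<close> where \<open>s\<close> begins.\<close>
  have "digit b (s * b ^ (l + t) + n) (i + (length w - 1 - k)) = digit b n (i + (length w - 1 - k))"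
    if "i < t" "k < length w" for i k
    using that assms(3) by (intro digit_add_mult_power) linarith
  then have "occ_set b w (s * b ^ (l + t) + n) \<inter> {..<t} = occ_set b w n \<inter> {..<t}"
    by (auto simp: occ_set_def)
  moreover have "(s * b ^ (l + t) + n) div b ^ t = s * b ^ l + n div b ^ t"
    using assms(1) by (simp add: power_add mult.assoc[symmetric])
  ultimately show ?thesis
    using occ_split[OF assms(1,2), of "s * b ^ (l + t) + n" t] occ_split[OF assms(1,2), of n t]
    by simp
qed

text \<open>In the exponent the products become the sums of \<open>occ_exchange\<close>, a form that
  avoids both division and subtraction of naturals.\<close>

lemma block_seq_exchange:
  assumes "b > 1" "fin_weighted b S" "\<And>w. S w \<noteq> 0 \<Longrightarrow> length w \<le> l"
  shows "block_seq b m S (s * b ^ (l + t) + n) * block_seq b m S (n div b ^ t)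
    = block_seq b m S n * block_seq b m S (s * b ^ l + n div b ^ t)"
proof -
  have occ: "real (occ b w (s * b ^ (l + t) + n)) + real (occ b w (n div b ^ t))
    = real (occ b w n) + real (occ b w (s * b ^ l + n div b ^ t))" if "S w \<noteq> 0" for w
  proof -
    have "\<exists>x\<in>set w. x \<noteq> 0" using assms(2) that by (auto simp: fin_weighted_def)
    from occ_exchange[OF assms(1) this assms(3)[OF that], of s t n] show ?thesis
      by (simp flip: of_nat_add)
  qed
  have "weighted_occ b S (s * b ^ (l + t) + n) + weighted_occ b S (n div b ^ t)
    = weighted_occ b S n + weighted_occ b S (s * b ^ l + n div b ^ t)"
    unfolding weighted_occ_def sum.distrib[symmetric] distrib_left[symmetric]
    using occ by (intro sum.cong) auto
  from arg_cong[OF this, of complex_of_real] show ?thesis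
    unfolding block_seq_def exp_add[symmetric] add_divide_distrib[symmetric]
      distrib_left[symmetric] of_real_add
    by simp
qed

lemma nth_concat_uniform:
  assumes "\<And>x. x \<in> set xs \<Longrightarrow> length (f x) = L" "i < length xs" "j < L"
  shows "concat (map f xs) ! (i * L + j) = f (xs ! i) ! j"
  using assms
proof (induction xs arbitrary: i)
  case (Cons x xs)
  then show ?case by (cases i) (auto simp: nth_append add.assoc)
qed simp

lemma length_phi [simp]: "length (phi b m T v) = length v"
  by (simp add: phi_def del: upt_Suc)

text \<open>The factor applied by \<open>phi\<close> depends only on the position and the length of
  the word, so the all-ones word isolates it; this links \<open>phi\<close> to
  \<open>V_word\<close>.\<close>

lemma phi_nth_factor:
  assumes "j < length v"
  shows "phi b m T v ! j = v ! j * phi b m T (replicate (length v) 1) ! j"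
  using assms by (simp add: phi_def del: upt_Suc)

lemma block_seq_V_word:
  assumes "generating_family b m l S Ss" "s < b" "j < b ^ l"
  shows "block_seq b m S (s * b ^ l + j) = block_seq b m S j * V_word b m l Ss s ! j"
proof -
  obtain u :: "nat \<Rightarrow> complex list" where u0: "length (u 0) = b ^ l"
    and step: "u (Suc 0) = u 0 @ concat (map (\<lambda>k. phi b m (Ss k) (u 0)) [1..<b])"
    and a: "\<And>t n. n < length (u t) \<Longrightarrow> u t ! n = block_seq b m S n"
    using assms(1) unfolding generating_family_def by blast
  \<comment> \<open>With \<open>u 0\<close> as block 0, matching the all-ones word
    \<open>V_word\<close> at 0, \<open>u (Suc 0)\<close> is a concatenation of \<open>b\<close>
    blocks of equal length.\<close>
  define f where "f k = (if k = 0 then u 0 else phi b m (Ss k) (u 0))" for k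
  have len: "length (f k) = b ^ l" for k by (simp add: f_def u0)
  have "[0..<b] = 0 # [1..<b]" using assms(2) by (simp add: upt_conv_Cons)
  moreover have "map (\<lambda>k. phi b m (Ss k) (u 0)) [1..<b] = map f [1..<b]"
    by (simp add: f_def)
  moreover have "f 0 = u 0" by (simp add: f_def)
  ultimately have u1: "u (Suc 0) = concat (map f [0..<b])"
    by (simp only: step list.map concat.simps)
  have "s * b ^ l + j < Suc s * b ^ l" using assms(3) by simp
  also have "\<dots> \<le> b * b ^ l" using assms(2) by (intro mult_right_mono) auto
  also have "\<dots> = length (u (Suc 0))"
    by (simp add: u1 length_concat comp_def len sum_list_triv)
  finally have "block_seq b m S (s * b ^ l + j) = f s ! j"
    using a[of "s * b ^ l + j" "Suc 0"] nth_concat_uniform[of "[0..<b]" f "b ^ l" s j] assms(2,3)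
    by (simp add: u1 len)
  also have "\<dots> = block_seq b m S j * V_word b m l Ss s ! j"
    using a[of j 0] assms(3) phi_nth_factor[of j "u 0" b m "Ss s"]
    by (simp add: f_def V_word_def u0)
  finally show ?thesis .
qed

lemma block_sums_nth:
  assumes "i < b ^ l"
  shows "block_sums b m l S t $ i = (\<Sum>x<b ^ t. block_seq b m S (i * b ^ t + x))"
  using assms sum.atLeastLessThan_shift_0[of "block_seq b m S" "i * b ^ t" "(i + 1) * b ^ t"]
  by (simp add: block_sums_def atLeast0LessThan add.commute)

text \<open>Of the \<open>l + t\<close> digits of the padded \<open>n\<close>, only the
  \<open>l\<close> leading ones, those of \<open>n div b ^ t\<close>, are within reach of a word
  that covers the new digit \<open>s\<close>.\<close>

lemma block_seq_prefix:
  assumes "b > 1" "fin_weighted b S" "\<And>w. S w \<noteq> 0 \<Longrightarrow> length w \<le> l"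
    and "generating_family b m l S Ss" "s < b" "n < b ^ (l + t)"
  shows "block_seq b m S (s * b ^ (l + t) + n)
    = V_word b m l Ss s ! (n div b ^ t) * block_seq b m S n"
proof -
  have "n div b ^ t < b ^ l"
    using assms(6) by (simp add: less_mult_imp_div_less power_add)
  with block_seq_V_word[OF assms(4,5)] block_seq_exchange[OF assms(1-3), of m s t n]
  have "block_seq b m S (s * b ^ (l + t) + n) * block_seq b m S (n div b ^ t)
    = V_word b m l Ss s ! (n div b ^ t) * block_seq b m S n * block_seq b m S (n div b ^ t)"
    by (simp add: mult.commute)
  moreover have "block_seq b m S (n div b ^ t) \<noteq> 0" by (simp add: block_seq_def)
  ultimately show ?thesis by simp
qed

lemma sum_lessThan_mult:
  fixes f :: "nat \<Rightarrow> 'a::comm_monoid_add"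
  shows "(\<Sum>y<p * k. f y) = (\<Sum>i<p. \<Sum>x<k. f (i * k + x))"
proof -
  have "sum f {i * k..<i * k + k} = (\<Sum>x<k. f (i * k + x))" for i
    using sum.atLeastLessThan_shift_0[of f "i * k" "i * k + k"]
    by (simp add: atLeast0LessThan add.commute)
  then show ?thesis by (simp flip: sum.nat_group)
qed

theorem theorem4:
  fixes b m l t :: nat
    and S :: "nat list \<Rightarrow> real"
    and Ss :: "nat \<Rightarrow> nat list \<Rightarrow> real"
  assumes "b > 1" and "m > 1"
    and "fin_weighted b S"
    and "\<exists>w. S w \<noteq> 0"
    and "l = Max {length w | w. S w \<noteq> 0}"
    and "generating_family b m l S Ss"
  shows "block_sums b m l S (t + 1) = assoc_mat b m l Ss *\<^sub>v block_sums b m l S t"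
proof (rule eq_vecI)
  have fin: "finite {length w | w. S w \<noteq> 0}"
    using assms(3) by (simp add: fin_weighted_def)
  have len: "length w \<le> l" if "S w \<noteq> 0" for w
    unfolding assms(5) using that by (intro Max_ge[OF fin]) auto
  obtain w where w: "S w \<noteq> 0" using assms(4) by blast
  \<comment> \<open>A weighted word has a nonzero letter, so it is nonempty and \<open>l - 1\<close>
    is a true difference.\<close>
  then have "w \<noteq> []" using assms(3) by (auto simp: fin_weighted_def)
  then have "l \<ge> 1" using len[OF w] by (cases w) auto
  then have bl: "b ^ l = b * b ^ (l - 1)" by (cases l) auto
  let ?a = "block_seq b m S"
  fix i assume "i < dim_vec (assoc_mat b m l Ss *\<^sub>v block_sums b m l S t)"
  then have i: "i < b ^ l" by (simp add: assoc_mat_def)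
  \<comment> \<open>Among the \<open>l\<close> digits of \<open>i\<close>, \<open>s\<close> is the
    leading one and \<open>q\<close> the rest; row \<open>i\<close> is supported on the columns
    \<open>q * b + p\<close> with \<open>p < b\<close>.\<close>
  define s q where "s = i div b ^ (l - 1)" and "q = i mod b ^ (l - 1)"
  let ?V = "V_word b m l Ss s"
  have s: "s < b" using i by (simp add: s_def bl less_mult_imp_div_less)
  have q: "q < b ^ (l - 1)" using assms(1) by (simp add: q_def)
  have i_eq: "i = s * b ^ (l - 1) + q"
    unfolding s_def q_def by (rule div_mult_mod_eq[symmetric])
  have col: "q * b + p < b ^ l" if "p < b" for p
  proof -
    have "q * b + p < Suc q * b" using that by simp
    also have "\<dots> \<le> b ^ (l - 1) * b" using q by (intro mult_right_mono) auto
    finally show ?thesis by (simp add: bl mult.commute)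
  qed
  \<comment> \<open>Appending the digit \<open>p\<close> to \<open>i\<close> and splitting off the
    leading digit \<open>s\<close> leaves \<open>q * b + p\<close>, again an index below
    \<open>b ^ l\<close>.\<close>
  have entry: "?a (i * b ^ Suc t + (p * b ^ t + x)) = ?V ! (q * b + p) * ?a ((q * b + p) * b ^ t + x)"
    if p: "p < b" and x: "x < b ^ t" for p x
  proof -
    have "i * b ^ Suc t + (p * b ^ t + x) = s * b ^ (l + t) + ((q * b + p) * b ^ t + x)"
      by (simp add: i_eq power_add bl algebra_simps)
    moreover have "(q * b + p) * b ^ t + x < b ^ (l + t)"
    proof -
      have "(q * b + p) * b ^ t + x < Suc (q * b + p) * b ^ t" using x by simp
      also have "\<dots> \<le> b ^ l * b ^ t" using col[OF p] by (intro mult_right_mono) auto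
      finally show ?thesis by (simp add: power_add)
    qed
    moreover have "((q * b + p) * b ^ t + x) div b ^ t = q * b + p"
      using x by (intro div_nat_eqI) auto
    ultimately show ?thesis
      using block_seq_prefix[OF assms(1,3) len assms(6) s, of "(q * b + p) * b ^ t + x" t] by metis
  qed
  have cols: "{j \<in> {0..<b ^ l}. j div b = q} = (\<lambda>p. q * b + p) ` {..<b}"
  proof (intro equalityI subsetI)
    fix j assume "j \<in> {j \<in> {0..<b ^ l}. j div b = q}"
    then have "j = q * b + j mod b" using div_mult_mod_eq[of j b] by simp
    then show "j \<in> (\<lambda>p. q * b + p) ` {..<b}"
      using assms(1) by (intro image_eqI[of _ _ "j mod b"]) auto
  qed (use col in auto)
  \<comment> \<open>The block of length \<open>b ^ (t + 1)\<close> is cut into \<open>b\<close>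
    blocks of length \<open>b ^ t\<close>, one for each \<open>p\<close>.\<close>
  have "block_sums b m l S (t + 1) $ i
    = (\<Sum>p<b. \<Sum>x<b ^ t. ?a (i * b ^ Suc t + (p * b ^ t + x)))"
    using i by (simp add: block_sums_nth sum_lessThan_mult)
  also have "\<dots> = (\<Sum>p<b. ?V ! (q * b + p) * block_sums b m l S t $ (q * b + p))"
    using col entry by (simp add: block_sums_nth sum_distrib_left)
  also have "\<dots> = (\<Sum>j | j \<in> {0..<b ^ l} \<and> j div b = q. ?V ! j * block_sums b m l S t $ j)"
    unfolding cols by (subst sum.reindex) (auto simp: inj_on_def)
  \<comment> \<open>Zeros off the support extend the sum to the full row.\<close>
  also have "\<dots> = (\<Sum>j = 0..<b ^ l. (if j div b = q then ?V ! j else 0) * block_sums b m l S t $ j)"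
    by (subst sum.inter_filter) (auto intro!: sum.cong)
  also have "\<dots> = (assoc_mat b m l Ss *\<^sub>v block_sums b m l S t) $ i"
    unfolding s_def q_def using i by (simp add: assoc_mat_def scalar_prod_def block_sums_def)
  finally show "block_sums b m l S (t + 1) $ i = (assoc_mat b m l Ss *\<^sub>v block_sums b m l S t) $ i" .
qed (simp add: block_sums_def assoc_mat_def)

end
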